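(* Let $\alpha\in(0,\infty)\setminus\{1\}$ and let all quantum systems be finite-dimensional. (i) Let $\rho_{AB}$ and $\bar\rho_{AB}$ be quantum states related by $$\bar\rho_{AB}=\frac{\Big(\rho_B^{\frac{1-\alpha}{2\alpha}}\rho_{AB}\,\rho_B^{\frac{1-\alpha}{2\alpha}}\Big)^\alpha}{\operatorname{Tr}\Big(\rho_B^{\frac{1-\alpha}{2\alpha}}\rho_{AB}\,\rho_B^{\frac{1-\alpha}{2\alpha}}\Big)^\alpha}.$$ Then $$\widetilde H^\downarrow_\alpha(A|B)_\rho=\bar H^\uparrow_{1/\alpha}(A|B)_{\bar\rho}.$$ (ii) Let $\rho_{ABC}$ be a quantum state and $$\widetilde\rho_{ABC}=\frac{\Big(\rho_C^{\frac{1-\alpha}{2\alpha}}\rho_{ABC}\,\rho_C^{\frac{1-\alpha}{2\alpha}}\Big)^\alpha}{\operatorname{Tr}\Big(\rho_C^{\frac{1-\alpha}{2\alpha}}\rho_{ABC}\,\rho_C^{\frac{1-\alpha}{2\alpha}}\Big)^\alpha}.$$ Then $$\widetilde H^\downarrow_\alpha(AB|C)_\rho=\bar H^\uparrow_{1/\alpha}(A|BC)_{\widetilde\rho}+\widetilde H^\downarrow_\alpha(B|C)_\rho=\bar H^\uparrow_{1/\alpha}(AB|C)_{\widetilde\rho}.$$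
   Context: A quantum state is a positive semidefinite matrix of trace one; $\rho_B=\operatorname{Tr}_A\rho_{AB}$ etc. denote reduced states (partial traces), and an operator such as $\rho_B^{s}$ inside an expression on $AB$ means $I_A\otimes\rho_B^{s}$. Powers of positive semidefinite matrices (including negative powers) are taken on the support. $\operatorname{Tr}M^\alpha$, also written $\operatorname{Tr}(M)^\alpha$, means $\operatorname{Tr}(M^\alpha)$. $\log$ is the natural logarithm. For $\alpha\in(0,\infty)\setminus\{1\}$, $$\widetilde H^\downarrow_\alpha(A|B)_\rho=\frac{1}{1-\alpha}\log\operatorname{Tr}\Big[\Big(\rho_B^{\frac{1-\alpha}{2\alpha}}\rho_{AB}\,\rho_B^{\frac{1-\alpha}{2\alpha}}\Big)^\alpha\Big],\qquad \bar H^\uparrow_\alpha(A|B)_\rho=\frac{\alpha}{1-\alpha}\log\operatorname{Tr}\Big[\big(\operatorname{Tr}_A\rho_{AB}^\alpha\big)^{1/\alpha}\Big].$$ In $\widetilde H^\downarrow_\alpha(AB|C)$ the pair $AB$ is treated as one system, in $\bar H^\uparrow_{1/\alpha}(A|BC)$ the pair $BC$ is treated as one conditioning system, and $\widetilde H^\downarrow_\alpha(B|C)_\rho$ is evaluated on $\rho_{BC}$. *)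

theory Defs
  imports "HOL-Analysis.Analysis"
begin

text \<open>
  A finite-dimensional system is represented by a finite index type of an orthonormal basis, so
  that an operator on it is a square complex matrix over that type; a composite system is the
  product type, with the conditioning system as the second factor.
\<close>

definition cadj :: "complex ^ ('n::finite) ^ ('m::finite) \<Rightarrow> complex ^ 'm ^ 'n" where
  "cadj M = (\<chi> i j. cnj (M $ j $ i))"

definition cunitary :: "complex ^ ('n::finite) ^ 'n \<Rightarrow> bool" where
  "cunitary U \<longleftrightarrow> U ** cadj U = mat 1 \<and> cadj U ** U = mat 1"

definition rdiag :: "('n::finite \<Rightarrow> real) \<Rightarrow> complex ^ 'n ^ 'n" where
  "rdiag d = (\<chi> i j. if i = j then complex_of_real (d i) else 0)"

definition psd :: "complex ^ ('n::finite) ^ 'n \<Rightarrow> bool" where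
  "psd M \<longleftrightarrow> cadj M = M \<and>
     (\<forall>v. 0 \<le> Re (\<Sum>i\<in>UNIV. \<Sum>j\<in>UNIV. cnj (v $ i) * M $ i $ j * v $ j))"

definition quantum_state :: "complex ^ ('n::finite) ^ 'n \<Rightarrow> bool" where
  "quantum_state \<rho> \<longleftrightarrow> psd \<rho> \<and> trace \<rho> = 1"

text \<open>
  Powers of a positive semidefinite matrix by functional calculus on its support: the exponent
  (possibly negative or zero) acts on the positive eigenvalues only, and the kernel is sent to
  zero. The result does not depend on the chosen diagonalization. The value is only meaningful
  for positive semidefinite matrices.
\<close>

definition mpow :: "complex ^ ('n::finite) ^ 'n \<Rightarrow> real \<Rightarrow> complex ^ 'n ^ 'n" where
  "mpow M s = (THE N. \<exists>U d. cunitary U \<and> M = U ** rdiag d ** cadj U \<and>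
     N = U ** rdiag (\<lambda>i. if d i > 0 then d i powr s else 0) ** cadj U)"

definition kron :: "complex ^ ('a::finite) ^ 'a \<Rightarrow> complex ^ ('b::finite) ^ 'b \<Rightarrow> complex ^ ('a \<times> 'b) ^ ('a \<times> 'b)" where
  "kron M N = (\<chi> i j. M $ fst i $ fst j * N $ snd i $ snd j)"

definition ptrace_fst :: "complex ^ ('a::finite \<times> 'b::finite) ^ ('a \<times> 'b) \<Rightarrow> complex ^ 'b ^ 'b" where
  "ptrace_fst M = (\<chi> i j. \<Sum>a\<in>UNIV. M $ (a, i) $ (a, j))"

text \<open>An operator on $(AB)C$ viewed as an operator on $A(BC)$.\<close>

definition regroup ::
  "complex ^ (('a::finite \<times> 'b::finite) \<times> 'c::finite) ^ (('a \<times> 'b) \<times> 'c) \<Rightarrow> complex ^ ('a \<times> 'b \<times> 'c) ^ ('a \<times> 'b \<times> 'c)" where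
  "regroup M = (\<chi> i j. case i of (a, b, c) \<Rightarrow> case j of (a', b', c') \<Rightarrow>
     M $ ((a, b), c) $ ((a', b'), c'))"

text \<open>
  Traces of positive semidefinite matrices are real; the real part only serves to
  convert them to type \<^typ>\<open>real\<close>.
\<close>

definition rtrace :: "complex ^ ('n::finite) ^ 'n \<Rightarrow> real" where
  "rtrace M = Re (trace M)"

definition sandwiched_power ::
  "real \<Rightarrow> complex ^ ('a::finite \<times> 'b::finite) ^ ('a \<times> 'b) \<Rightarrow> complex ^ ('a \<times> 'b) ^ ('a \<times> 'b)" where
  "sandwiched_power \<alpha> \<rho> =
     (let S = kron (mat 1) (mpow (ptrace_fst \<rho>) ((1 - \<alpha>) / (2 * \<alpha>)))
      in mpow (S ** \<rho> ** S) \<alpha>)"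

definition H_tilde_down :: "real \<Rightarrow> complex ^ ('a::finite \<times> 'b::finite) ^ ('a \<times> 'b) \<Rightarrow> real" where
  "H_tilde_down \<alpha> \<rho> = 1 / (1 - \<alpha>) * ln (rtrace (sandwiched_power \<alpha> \<rho>))"

definition H_bar_up :: "real \<Rightarrow> complex ^ ('a::finite \<times> 'b::finite) ^ ('a \<times> 'b) \<Rightarrow> real" where
  "H_bar_up \<alpha> \<rho> =
     \<alpha> / (1 - \<alpha>) * ln (rtrace (mpow (ptrace_fst (mpow \<rho> \<alpha>)) (1 / \<alpha>)))"

end

theory Submission
  imports Defs
begin

text \<open>
  Write $X$ for the operator $\rho_B^{s}\rho_{AB}\,\rho_B^{s}$ with $s=(1-\alpha)/(2\alpha)$.
  Taking the partial trace gives $\operatorname{Tr}_A X=\rho_B^{2s+1}=\rho_B^{1/\alpha}$, and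
  raising the normalized state $X^\alpha/Q$, $Q=\operatorname{Tr}X^\alpha$, to the power $1/\alpha$
  recovers $X$ up to the factor $Q^{-1/\alpha}$. Hence the trace inside $\bar H^\uparrow_{1/\alpha}$ is
  $\operatorname{Tr}\rho_B/Q=1/Q$. In the tripartite case, tracing out only $A$ from $X$ yields the
  operator $X$ that belongs to $\rho_{BC}$, so the inner trace becomes $Q_{BC}/Q$.
\<close>

section \<open>Algebra of adjoints, real diagonal matrices and real scaling\<close>

lemma cadj_cadj [simp]: "cadj (cadj M) = M"
  by (simp add: cadj_def vec_eq_iff)

lemma cadj_matrix_mult: "cadj (M ** N) = cadj N ** cadj M"
  by (simp add: cadj_def matrix_matrix_mult_def vec_eq_iff mult.commute)

lemma cadj_rdiag [simp]: "cadj (rdiag d) = rdiag d"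
  by (auto simp: cadj_def rdiag_def vec_eq_iff)

lemma cadj_mat_1 [simp]: "cadj (mat 1) = mat 1"
  by (auto simp: cadj_def mat_def vec_eq_iff)

lemma rdiag_mult_left: "(rdiag d ** M) $ i $ j = d i * M $ i $ j"
  by (simp add: rdiag_def matrix_matrix_mult_def if_distrib if_distribR sum.delta' cong: if_cong)

lemma rdiag_mult_right: "(M ** rdiag d) $ i $ j = M $ i $ j * d j"
  by (simp add: rdiag_def matrix_matrix_mult_def if_distrib if_distribR sum.delta cong: if_cong)

lemma rdiag_mult: "rdiag d ** rdiag e = rdiag (\<lambda>i. d i * e i)"
  by (simp add: vec_eq_iff rdiag_mult_left) (simp add: rdiag_def)

lemma rdiag_vector_mult: "(rdiag d *v v) $ i = d i * v $ i"
  by (simp add: rdiag_def matrix_vector_mult_def if_distrib if_distribR sum.delta' cong: if_cong)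

lemma rdiag_scaleR: "rdiag (\<lambda>i. c * d i) = c *\<^sub>R rdiag d"
  by (simp add: rdiag_def vec_eq_iff) (simp add: scaleR_conv_of_real)

lemma scaleR_matrix_mult_left:
  fixes M :: "complex ^ 'n::finite ^ 'm::finite"
  shows "(c *\<^sub>R M) ** N = c *\<^sub>R (M ** N)"
  by (simp add: matrix_matrix_mult_def vec_eq_iff scaleR_sum_right)

lemma scaleR_matrix_mult_right:
  fixes M :: "complex ^ 'n::finite ^ 'm::finite"
  shows "M ** (c *\<^sub>R N) = c *\<^sub>R (M ** N)"
  by (simp add: matrix_matrix_mult_def vec_eq_iff scaleR_sum_right)

subsection \<open>Diagonalization of Hermitian matrices\<close>

definition hinner :: "complex ^ 'n::finite \<Rightarrow> complex ^ 'n \<Rightarrow> complex" where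
  "hinner u v = (\<Sum>i\<in>UNIV. cnj (u $ i) * v $ i)"

text \<open>Bridge between two structures: compactness, span and dimension arguments use the real
  inner product, while unitarity needs Hermitian orthogonality.\<close>

lemma inner_eq_Re_hinner: "u \<bullet> v = Re (hinner u v)"
  by (simp add: hinner_def inner_vec_def inner_complex_def)

lemma hinner_commute: "hinner v u = cnj (hinner u v)"
  by (simp add: hinner_def mult.commute)

lemma hinner_add_right: "hinner u (v + w) = hinner u v + hinner u w"
  by (simp add: hinner_def ring_distribs sum.distrib)

lemma hinner_cmult_right: "hinner u (c *s v) = c * hinner u v"
  by (simp add: hinner_def sum_distrib_left mult_ac)

lemma hinner_cmult_left: "hinner (c *s u) v = cnj c * hinner u v"
  by (simp add: hinner_def sum_distrib_left mult_ac)

lemma scaleR_vec_conv_cmult: "c *\<^sub>R (v :: complex ^ 'n) = complex_of_real c *s v"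
  by (simp add: vec_eq_iff) (simp add: scaleR_conv_of_real)

lemma hinner_self: "hinner v v = complex_of_real ((norm v)\<^sup>2)"
proof -
  have "Re (hinner v v) = (norm v)\<^sup>2"
    by (simp add: inner_eq_Re_hinner [symmetric] power2_norm_eq_inner)
  moreover have "Im (hinner v v) = 0"
    by (simp add: hinner_def mult.commute)
  ultimately show ?thesis
    by (simp add: complex_eq_iff)
qed

lemma hinner_adjoint: "hinner (M *v u) v = hinner u (cadj M *v v)"
proof -
  have "hinner (M *v u) v = (\<Sum>i\<in>UNIV. \<Sum>j\<in>UNIV. cnj (M $ i $ j) * cnj (u $ j) * v $ i)"
    by (simp add: hinner_def matrix_vector_mult_def sum_distrib_right)
  also have "\<dots> = (\<Sum>j\<in>UNIV. \<Sum>i\<in>UNIV. cnj (M $ i $ j) * cnj (u $ j) * v $ i)"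
    by (rule sum.swap)
  also have "\<dots> = hinner u (cadj M *v v)"
    by (simp add: hinner_def matrix_vector_mult_def cadj_def sum_distrib_left mult_ac)
  finally show ?thesis .
qed

lemma matrix_scaleR_vec: "M *v (c *\<^sub>R v) = c *\<^sub>R (M *v (v :: complex ^ 'n::finite))"
  by (simp add: matrix_vector_mult_def vec_eq_iff scaleR_sum_right)

text \<open>Dimension count over the reals: being orthogonal to $u$ in the Hermitian sense means being
  real-orthogonal to both $u$ and $\mathrm{i}u$.\<close>

lemma hinner_complement_nonzero:
  fixes u :: "'n::finite \<Rightarrow> complex ^ 'n"
  assumes "F \<noteq> UNIV"
  obtains v where "v \<noteq> 0" "\<And>i. i \<in> F \<Longrightarrow> hinner (u i) v = 0"
proof -
  let ?B = "u ` F \<union> (\<lambda>i. \<i> *s u i) ` F"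
  have "card F < CARD('n)"
    using assms by (simp add: psubset_card_mono psubset_eq)
  moreover have "dim ?B \<le> card ?B"
    by (rule dim_le_card') simp
  moreover have "card ?B \<le> card F + card F"
    by (intro order.trans [OF card_Un_le] add_mono card_image_le) simp_all
  ultimately have "dim ?B < DIM(complex ^ 'n)"
    by simp
  then have "dim (span ?B) < DIM(complex ^ 'n)"
    by simp
  then have "span ?B \<noteq> UNIV"
    by (metis dim_UNIV less_irrefl)
  then obtain v where v: "v \<noteq> 0" "\<And>x. x \<in> span ?B \<Longrightarrow> v \<bullet> x = 0"
    using span_not_UNIV_orthogonal by blast
  have "hinner (u i) v = 0" if "i \<in> F" for i
  proof (rule complex_eqI)
    have "v \<bullet> u i = 0" "v \<bullet> (\<i> *s u i) = 0"
      using that by (auto intro!: v(2) span_base)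
    \<comment> \<open>Conjugate linearity in the first argument makes the second real part equal to
      \<open>Im (hinner (u i) v)\<close>.\<close>
    then have "Re (hinner (u i) v) = 0" "Re (hinner (\<i> *s u i) v) = 0"
      by (simp_all add: inner_eq_Re_hinner [symmetric] inner_commute)
    then show "Re (hinner (u i) v) = Re 0" "Im (hinner (u i) v) = Im 0"
      by (simp_all add: hinner_cmult_left)
  qed
  with v show thesis
    using that by blast
qed

text \<open>The polynomial in t vanishes at 0 and is nonnegative, so 0 is a minimum and the
  derivative 2b there is zero.\<close>

lemma quadratic_nonneg_imp_linear_zero:
  fixes b c :: real
  assumes "\<And>t. 0 \<le> 2 * t * b + t\<^sup>2 * c"
  shows "b = 0"
proof (rule ccontr)
  assume "b \<noteq> 0"
  \<comment> \<open>For this t the quadratic term is at most -(t b), so the whole polynomial is at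
    most t b < 0; the added 1 keeps the denominator positive.\<close>
  define t where "t = - b / (\<bar>c\<bar> + 1)"
  have "t\<^sup>2 * c \<le> t\<^sup>2 * (\<bar>c\<bar> + 1)"
    by (intro mult_left_mono) auto
  also have "\<dots> = - (t * b)"
    by (simp add: t_def power2_eq_square field_simps add_nonneg_eq_0_iff)
  finally have "0 \<le> t * b"
    using assms [of t] by linarith
  moreover have "t * b < 0"
    using \<open>b \<noteq> 0\<close> by (simp add: t_def divide_less_0_iff not_square_less_zero
        zero_less_mult_iff add_nonneg_pos less_le)
  ultimately show False by simp
qed

text \<open>The eigenvector maximizes the Rayleigh quotient on the subspace; $r = (l - M)v$ vanishes because
  the nonnegative form $y \mapsto \langle y, (l - M) y\rangle$ is zero at $v$, hence stationary there
  in the direction $r$.\<close>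

lemma hermitian_eigenvector_in_subspace:
  fixes M :: "complex ^ 'n::finite ^ 'n" and W :: "(complex ^ 'n) set"
  assumes herm: "cadj M = M"
    and W: "subspace W" and inv: "\<And>w. w \<in> W \<Longrightarrow> M *v w \<in> W"
    and x: "x \<in> W" "x \<noteq> 0"
  obtains v l where "v \<in> W" "norm v = 1" "M *v v = l *\<^sub>R v"
proof -
  have adj: "(M *v y) \<bullet> z = y \<bullet> (M *v z)" for y z
    by (simp add: inner_eq_Re_hinner hinner_adjoint herm)
  have "(1 / norm x) *\<^sub>R x \<in> W \<inter> sphere 0 1"
    using x W by (simp add: subspace_scale)
  moreover have "compact (W \<inter> sphere 0 1)"
    using W by (simp add: closed_subspace closed_Int_compact)
  moreover have "linear ((*v) M)"
    by (intro linearI) (simp_all add: matrix_vector_right_distrib matrix_scaleR_vec)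
  then have "continuous_on (W \<inter> sphere 0 1) (\<lambda>y. y \<bullet> (M *v y))"
    by (intro continuous_intros linear_continuous_on) (simp add: linear_conv_bounded_linear)
  ultimately obtain v where v: "v \<in> W" "norm v = 1"
    and max: "\<And>y. y \<in> W \<Longrightarrow> norm y = 1 \<Longrightarrow> y \<bullet> (M *v y) \<le> v \<bullet> (M *v v)"
    using continuous_attains_sup [of "W \<inter> sphere 0 1" "\<lambda>y. y \<bullet> (M *v y)"]
    by fastforce
  define l where "l = v \<bullet> (M *v v)"
  define r where "r = l *\<^sub>R v - M *v v"
  \<comment> \<open>Homogeneity extends the maximum from the unit sphere to all of W.\<close>
  have bound: "y \<bullet> (M *v y) \<le> l * (y \<bullet> y)" if "y \<in> W" for y
  proof (cases "y = 0")
    case False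
    have "((1 / norm y) *\<^sub>R y) \<bullet> (M *v ((1 / norm y) *\<^sub>R y)) \<le> l"
      unfolding l_def using that False W by (intro max) (simp_all add: subspace_scale)
    then have "(y \<bullet> (M *v y)) / (norm y)\<^sup>2 \<le> l"
      by (simp add: matrix_scaleR_vec power2_eq_square)
    then show ?thesis
      using False by (simp add: pos_divide_le_eq power2_norm_eq_inner)
  qed simp
  have rW: "r \<in> W"
    using v W inv by (simp add: r_def subspace_diff subspace_scale)
  have vv: "v \<bullet> v = 1"
    using v(2) by (simp add: norm_eq_1)
  have "r \<bullet> r = 0"
  \<comment> \<open>Expand \<open>bound\<close> at v + t r. The constant term cancels by the choice
    of l, and half the linear coefficient is the inner product of r with l v - M v = r.\<close>
  proof (rule quadratic_nonneg_imp_linear_zero)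
    fix t :: real
    have "v + t *\<^sub>R r \<in> W"
      using v rW W by (simp add: subspace_add subspace_scale)
    from bound [OF this]
    have "0 \<le> l * (v \<bullet> v + 2 * t * (r \<bullet> v) + t\<^sup>2 * (r \<bullet> r))
        - (v \<bullet> (M *v v) + 2 * t * (r \<bullet> (M *v v)) + t\<^sup>2 * (r \<bullet> (M *v r)))"
      using adj [of r v]
      by (simp add: matrix_scaleR_vec matrix_vector_right_distrib inner_add_left inner_add_right
          power2_eq_square algebra_simps inner_commute)
    also have "\<dots> = 2 * t * (r \<bullet> (l *\<^sub>R v - M *v v)) + t\<^sup>2 * (l * (r \<bullet> r) - r \<bullet> (M *v r))"
      using vv by (simp add: l_def [symmetric] inner_diff_right algebra_simps)
    finally show "0 \<le> 2 * t * (r \<bullet> r) + t\<^sup>2 * (l * (r \<bullet> r) - r \<bullet> (M *v r))"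
      by (simp add: r_def [symmetric])
  qed
  then have "M *v v = l *\<^sub>R v"
    by (simp add: r_def)
  with v that show thesis by blast
qed

text \<open>Induction on F: the orthogonal complement of the eigenvectors found so far is
  M-invariant because M is Hermitian, and nonzero because F is still a proper subset of the index
  type. It therefore contains a further unit eigenvector.\<close>

lemma hermitian_orthonormal_eigenvectors:
  fixes M :: "complex ^ 'n::finite ^ 'n" and F :: "'n set"
  assumes herm: "cadj M = M" and "finite F"
  shows "\<exists>u d. \<forall>i\<in>F. M *v u i = d i *\<^sub>R u i \<and>
    (\<forall>j\<in>F. hinner (u i) (u j) = (if i = j then 1 else 0))"
  using \<open>finite F\<close>
proof (induction F rule: finite_induct)
  case (insert k F)
  then obtain u :: "'n \<Rightarrow> complex ^ 'n" and d where
    eig: "\<And>i. i \<in> F \<Longrightarrow> M *v u i = d i *\<^sub>R u i"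
    and orth: "\<And>i j. i \<in> F \<Longrightarrow> j \<in> F \<Longrightarrow> hinner (u i) (u j) = (if i = j then 1 else 0)"
    by blast
  define W where "W = {w. \<forall>i\<in>F. hinner (u i) w = 0}"
  have "subspace W"
    by (auto simp: W_def subspace_def hinner_add_right scaleR_vec_conv_cmult hinner_cmult_right)
      (simp add: hinner_def)
  moreover have "M *v w \<in> W" if "w \<in> W" for w
  proof -
    have "hinner (u i) (M *v w) = 0" if "i \<in> F" for i
    proof -
      have "hinner (u i) (M *v w) = hinner (M *v u i) w"
        by (simp add: hinner_adjoint herm)
      then show ?thesis
        using that \<open>w \<in> W\<close>
        by (simp add: eig W_def scaleR_vec_conv_cmult hinner_cmult_left)
    qed
    then show ?thesis by (simp add: W_def)
  qed
  moreover obtain x where "x \<in> W" "x \<noteq> 0"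
  proof -
    have "F \<noteq> UNIV"
      using insert.hyps by blast
    then obtain x where "x \<noteq> 0" "\<And>i. i \<in> F \<Longrightarrow> hinner (u i) x = 0"
      using hinner_complement_nonzero [of F u] by metis
    then show thesis
      by (intro that [of x]) (simp_all add: W_def)
  qed
  ultimately obtain v l where v: "v \<in> W" "norm v = 1" "M *v v = l *\<^sub>R v"
    using hermitian_eigenvector_in_subspace [OF herm] by metis
  have "hinner (u i) v = 0" "hinner v (u i) = 0" if "i \<in> F" for i
    using v that hinner_commute [of v "u i"] by (auto simp: W_def)
  moreover have "hinner v v = 1"
    by (simp add: hinner_self v)
  ultimately show ?case
    using v insert.hyps eig orth
    by (intro exI [of _ "u(k := v)"] exI [of _ "d(k := l)"]) auto
qed auto

text \<open>The orthonormal eigenvectors are the columns of U. Orthonormality gives one half of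
  unitarity, and squareness of U the other.\<close>

lemma hermitian_diagonalization:
  fixes M :: "complex ^ 'n::finite ^ 'n"
  assumes herm: "cadj M = M"
  obtains U d where "cunitary U" "M = U ** rdiag d ** cadj U"
proof -
  obtain u :: "'n \<Rightarrow> complex ^ 'n" and d where
    "\<forall>i\<in>UNIV. M *v u i = d i *\<^sub>R u i \<and>
      (\<forall>j\<in>UNIV. hinner (u i) (u j) = (if i = j then 1 else 0))"
    using hermitian_orthonormal_eigenvectors [OF herm finite] by blast
  then have eig: "M *v u i = d i *\<^sub>R u i"
    and orth: "hinner (u i) (u j) = (if i = j then 1 else 0)" for i j
    by auto
  define U where "U = (\<chi> i j. u j $ i)"
  have UU: "cadj U ** U = mat 1"
    using orth by (simp add: U_def vec_eq_iff matrix_matrix_mult_def cadj_def mat_def hinner_def)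
  then have UU': "U ** cadj U = mat 1"
    using matrix_left_right_inverse by blast
  have MU: "M ** U = U ** rdiag d"
  proof -
    have "(M ** U) $ i $ j = (U ** rdiag d) $ i $ j" for i j
    proof -
      have "(M ** U) $ i $ j = (M *v u j) $ i"
        by (simp add: U_def matrix_matrix_mult_def matrix_vector_mult_def)
      also have "\<dots> = (U ** rdiag d) $ i $ j"
        unfolding eig rdiag_mult_right by (simp add: U_def) (simp add: scaleR_conv_of_real)
      finally show ?thesis .
    qed
    then show ?thesis by (simp add: vec_eq_iff)
  qed
  have "M = M ** (U ** cadj U)"
    by (simp add: UU')
  then have "M = U ** rdiag d ** cadj U"
    by (simp only: matrix_mul_assoc MU)
  with UU UU' show thesis
    by (intro that [of U d]) (simp_all add: cunitary_def)
qed


subsection \<open>Powers of positive semidefinite matrices\<close>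

lemma psd_iff: "psd M \<longleftrightarrow> cadj M = M \<and> (\<forall>v. 0 \<le> Re (hinner v (M *v v)))"
  by (simp add: psd_def hinner_def matrix_vector_mult_def sum_distrib_left mult.assoc)

lemma psd_congruence:
  assumes "psd M"
  shows "psd (A ** M ** cadj A)"
proof -
  have "hinner v ((A ** M ** cadj A) *v v) = hinner (cadj A *v v) (M *v (cadj A *v v))" for v
    by (simp add: hinner_adjoint matrix_vector_mul_assoc matrix_mul_assoc)
  then show ?thesis
    using assms by (simp add: psd_iff cadj_matrix_mult matrix_mul_assoc)
qed

lemma psd_rdiag:
  assumes "\<And>i. d i \<ge> 0"
  shows "psd (rdiag d)"
proof -
  have "Re (hinner v (rdiag d *v v)) = (\<Sum>i\<in>UNIV. d i * (cmod (v $ i))\<^sup>2)" for v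
    by (simp add: hinner_def rdiag_vector_mult cmod_power2 algebra_simps)
      (simp add: power2_eq_square)
  then show ?thesis
    using assms by (simp add: psd_iff sum_nonneg)
qed

text \<open>Congruence by \<open>cadj U\<close> shows that \<open>rdiag d\<close> is itself positive
  semidefinite; its form at a basis vector is the eigenvalue d i.\<close>

lemma psd_diagonalization:
  fixes M :: "complex ^ 'n::finite ^ 'n"
  assumes "psd M"
  obtains U d where "cunitary U" "M = U ** rdiag d ** cadj U" "\<And>i. d i \<ge> 0"
proof -
  obtain U d where U: "cunitary U" "M = U ** rdiag d ** cadj U"
    using assms hermitian_diagonalization unfolding psd_def by blast
  have "cadj U ** M ** U = (cadj U ** U) ** rdiag d ** (cadj U ** U)"
    by (simp add: U(2) matrix_mul_assoc)
  also have "\<dots> = rdiag d"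
    using U(1) by (simp add: cunitary_def)
  finally have D: "psd (rdiag d)"
    using psd_congruence [OF assms, of "cadj U"] by simp
  have "d i \<ge> 0" for i
  proof -
    have "hinner (axis i 1) (rdiag d *v axis i 1) = d i"
      by (simp add: hinner_def rdiag_vector_mult axis_def if_distrib if_distribR cong: if_cong)
    moreover have "0 \<le> Re (hinner (axis i 1) (rdiag d *v axis i 1))"
      using D by (simp add: psd_iff)
    ultimately show ?thesis by simp
  qed
  with U that show thesis by blast
qed

text \<open>Scalar function behind \<open>mpow\<close>. Exponent 0 gives the indicator of the
  positive reals, so \<open>mpow M 0\<close> is the support projection of a positive semidefinite
  M.\<close>

abbreviation ppow :: "real \<Rightarrow> real \<Rightarrow> real" where
  "ppow x s \<equiv> if x > 0 then x powr s else 0"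

text \<open>A unitary intertwining two diagonal matrices only connects equal eigenvalues, hence also
  intertwines their images under any function.\<close>

lemma diagonalization_function_unique:
  assumes "cunitary U" "cunitary V" and eq: "U ** rdiag d ** cadj U = V ** rdiag e ** cadj V"
  shows "U ** rdiag (\<lambda>i. f (d i)) ** cadj U = V ** rdiag (\<lambda>i. f (e i)) ** cadj V"
proof -
  define W where "W = cadj V ** U"
  have UV: "cadj U ** U = mat 1" "U ** cadj U = mat 1" "cadj V ** V = mat 1" "V ** cadj V = mat 1"
    using assms by (auto simp: cunitary_def)
  have "W ** rdiag d = cadj V ** (U ** rdiag d ** cadj U) ** U"
    by (simp add: W_def flip: matrix_mul_assoc) (simp add: UV)
  also have "\<dots> = (cadj V ** V) ** rdiag e ** W"
    unfolding eq by (simp add: W_def matrix_mul_assoc)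
  finally have "W ** rdiag d = rdiag e ** W"
    by (simp add: UV)
  then have "W $ i $ j * d j = e i * W $ i $ j" for i j
    by (metis rdiag_mult_left rdiag_mult_right)
  then have "W $ i $ j = 0 \<or> d j = e i" for i j
    by (metis mult.commute mult_cancel_left of_real_eq_iff)
  then have "(W ** rdiag (\<lambda>i. f (d i))) $ i $ j = (rdiag (\<lambda>i. f (e i)) ** W) $ i $ j" for i j
    unfolding rdiag_mult_left rdiag_mult_right by (metis mult.commute mult_zero_left)
  then have W: "W ** rdiag (\<lambda>i. f (d i)) = rdiag (\<lambda>i. f (e i)) ** W"
    by (simp add: vec_eq_iff)
  have "U ** rdiag (\<lambda>i. f (d i)) ** cadj U = (V ** cadj V) ** U ** rdiag (\<lambda>i. f (d i)) ** cadj U"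
    by (simp add: UV)
  also have "\<dots> = V ** (W ** rdiag (\<lambda>i. f (d i))) ** cadj U"
    by (simp add: W_def matrix_mul_assoc)
  also have "\<dots> = V ** rdiag (\<lambda>i. f (e i)) ** cadj V ** (U ** cadj U)"
    unfolding W by (simp add: W_def matrix_mul_assoc)
  finally show ?thesis
    by (simp add: UV)
qed

text \<open>Makes the definite description in \<open>mpow\<close> usable: any diagonalization serves
  as witness, and all of them yield the same value. Every later fact on powers reduces to one on
  eigenvalues.\<close>

lemma mpow_diagonalization:
  assumes "cunitary U"
  shows "mpow (U ** rdiag d ** cadj U) s = U ** rdiag (\<lambda>i. ppow (d i) s) ** cadj U"
  unfolding mpow_def
proof (rule the_equality)
  show "\<exists>V e. cunitary V \<and> U ** rdiag d ** cadj U = V ** rdiag e ** cadj V \<and>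
      U ** rdiag (\<lambda>i. ppow (d i) s) ** cadj U = V ** rdiag (\<lambda>i. ppow (e i) s) ** cadj V"
    using assms by blast
next
  fix N
  assume "\<exists>V e. cunitary V \<and> U ** rdiag d ** cadj U = V ** rdiag e ** cadj V \<and>
      N = V ** rdiag (\<lambda>i. ppow (e i) s) ** cadj V"
  then obtain V e where "cunitary V" "U ** rdiag d ** cadj U = V ** rdiag e ** cadj V"
    and N: "N = V ** rdiag (\<lambda>i. ppow (e i) s) ** cadj V"
    by (elim exE conjE)
  from diagonalization_function_unique [OF assms this(1,2), where f = "\<lambda>x. ppow x s"]
  show "N = U ** rdiag (\<lambda>i. ppow (d i) s) ** cadj U"
    unfolding N by (rule sym)
qed

lemma psd_mpow:
  assumes "psd M"
  shows "psd (mpow M s)"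
  using assms
  by (elim psd_diagonalization) (simp add: mpow_diagonalization psd_congruence psd_rdiag)

lemma mpow_1:
  assumes "psd M"
  shows "mpow M 1 = M"
proof -
  obtain U d where U: "cunitary U" "M = U ** rdiag d ** cadj U" "\<And>i. d i \<ge> 0"
    by (rule psd_diagonalization [OF assms]) (rule that)
  have "(\<lambda>i. ppow (d i) 1) = d"
    using U(3) by (auto simp: fun_eq_iff order.order_iff_strict)
  then show ?thesis
    using U by (simp add: mpow_diagonalization)
qed

lemma mpow_mpow:
  assumes "psd M"
  shows "mpow (mpow M s) t = mpow M (s * t)"
proof -
  obtain U d where U: "cunitary U" "M = U ** rdiag d ** cadj U"
    by (rule psd_diagonalization [OF assms]) (rule that)
  have "(\<lambda>i. ppow (ppow (d i) s) t) = (\<lambda>i. ppow (d i) (s * t))"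
    by (auto simp: fun_eq_iff powr_powr)
  then show ?thesis
    using U by (simp only: mpow_diagonalization)
qed

text \<open>Exponents of any sign add on the support, and both sides vanish on the kernel; for s + t
  = 0 the product is the support projection.\<close>

lemma mpow_mult:
  assumes "psd M"
  shows "mpow M s ** mpow M t = mpow M (s + t)"
proof -
  obtain U d where U: "cunitary U" "M = U ** rdiag d ** cadj U"
    by (rule psd_diagonalization [OF assms]) (rule that)
  have "mpow M s ** mpow M t
      = U ** rdiag (\<lambda>i. ppow (d i) s) ** (cadj U ** U) ** rdiag (\<lambda>i. ppow (d i) t) ** cadj U"
    using U by (simp only: mpow_diagonalization matrix_mul_assoc)
  also have "\<dots> = U ** (rdiag (\<lambda>i. ppow (d i) s) ** rdiag (\<lambda>i. ppow (d i) t)) ** cadj U"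
    using U(1) by (simp add: cunitary_def matrix_mul_assoc)
  also have "\<dots> = U ** rdiag (\<lambda>i. ppow (d i) (s + t)) ** cadj U"
  proof -
    have "(\<lambda>i. ppow (d i) s * ppow (d i) t) = (\<lambda>i. ppow (d i) (s + t))"
      by (auto simp: fun_eq_iff powr_add)
    then show ?thesis
      by (simp only: rdiag_mult)
  qed
  finally show ?thesis
    using U by (simp only: mpow_diagonalization)
qed

lemma mpow_scaleR:
  assumes "psd M" and "c > 0"
  shows "mpow (c *\<^sub>R M) s = (c powr s) *\<^sub>R mpow M s"
proof -
  obtain U d where U: "cunitary U" "M = U ** rdiag d ** cadj U" "\<And>i. d i \<ge> 0"
    by (rule psd_diagonalization [OF assms(1)]) (rule that)
  have "c *\<^sub>R M = U ** rdiag (\<lambda>i. c * d i) ** cadj U"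
    by (simp only: U(2) rdiag_scaleR scaleR_matrix_mult_left scaleR_matrix_mult_right)
  then have "mpow (c *\<^sub>R M) s = U ** rdiag (\<lambda>i. ppow (c * d i) s) ** cadj U"
    by (simp only: mpow_diagonalization [OF U(1)])
  moreover have "(\<lambda>i. ppow (c * d i) s) = (\<lambda>i. c powr s * ppow (d i) s)"
    using \<open>c > 0\<close> U(3) by (auto simp: fun_eq_iff powr_mult zero_less_mult_iff)
  moreover have "mpow M s = U ** rdiag (\<lambda>i. ppow (d i) s) ** cadj U"
    unfolding U(2) by (rule mpow_diagonalization [OF U(1)])
  ultimately show ?thesis
    by (simp only: rdiag_scaleR scaleR_matrix_mult_left scaleR_matrix_mult_right)
qed

lemma rtrace_scaleR: "rtrace (c *\<^sub>R M) = c * rtrace M"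
  by (simp add: rtrace_def trace_def sum_distrib_left)

text \<open>The trace is the sum of \<open>ppow (d i) s\<close> over the eigenvalues, and a nonzero
  positive semidefinite matrix has a positive one.\<close>

lemma rtrace_mpow_pos:
  assumes "psd M" and "M \<noteq> 0"
  shows "rtrace (mpow M s) > 0"
proof -
  obtain U d where U: "cunitary U" "M = U ** rdiag d ** cadj U" "\<And>i. d i \<ge> 0"
    by (rule psd_diagonalization [OF assms(1)]) (rule that)
  have "trace (mpow M s) = trace (cadj U ** (U ** rdiag (\<lambda>i. ppow (d i) s)))"
    using U by (simp add: mpow_diagonalization trace_mul_sym [of "cadj U"])
  also have "\<dots> = trace (rdiag (\<lambda>i. ppow (d i) s))"
    using U(1) by (simp add: matrix_mul_assoc cunitary_def)
  finally have tr: "rtrace (mpow M s) = (\<Sum>i\<in>UNIV. ppow (d i) s)"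
    by (simp add: rtrace_def trace_def rdiag_def)
  have "\<exists>i. d i > 0"
  proof (rule ccontr)
    assume "\<not> (\<exists>i. d i > 0)"
    \<comment> \<open>The form \<open>0 * 0\<close> lets \<open>rdiag_scaleR\<close> pull a zero
      scalar out of the diagonalization.\<close>
    then have "d = (\<lambda>i. 0 * 0)"
      using U(3) by (auto simp: fun_eq_iff order.antisym not_less)
    then have "M = 0"
      unfolding U(2)
      by (simp only: rdiag_scaleR scaleR_matrix_mult_left scaleR_matrix_mult_right) simp
    with \<open>M \<noteq> 0\<close> show False by simp
  qed
  then obtain i where "d i > 0" ..
  then show ?thesis
    unfolding tr by (intro sum_pos2 [of _ i]) auto
qed

subsection \<open>Partial traces and regrouping\<close>

lemma sum_prod_UNIV:
  "(\<Sum>p\<in>UNIV. f p) = (\<Sum>a\<in>UNIV. \<Sum>b\<in>UNIV. f (a :: 'a::finite, b :: 'b::finite))"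
  by (simp add: UNIV_Times_UNIV [symmetric] sum.cartesian_product' del: UNIV_Times_UNIV)

text \<open>The form of the partial trace at v is the sum over a of the form of M at the product
  vector of the basis vector a and v, called \<open>w a\<close> below; each summand is
  nonnegative.\<close>

lemma psd_ptrace_fst:
  fixes M :: "complex ^ ('a::finite \<times> 'b::finite) ^ ('a \<times> 'b)"
  assumes "psd M"
  shows "psd (ptrace_fst M)"
  unfolding psd_def
proof (intro conjI allI)
  have "cnj (M $ j $ i) = M $ i $ j" for i j
  proof -
    have "cadj M $ i $ j = M $ i $ j"
      using assms by (simp add: psd_iff)
    then show ?thesis
      by (simp add: cadj_def)
  qed
  then show "cadj (ptrace_fst M) = ptrace_fst M"
    by (simp add: cadj_def ptrace_fst_def vec_eq_iff)
next
  fix v :: "complex ^ 'b"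
  define w where "w a = (\<chi> p. if fst p = a then v $ snd p else 0)" for a :: 'a
  define F where "F a i j = cnj (v $ i) * M $ (a, i) $ (a, j) * v $ j" for a i j
  have *: "(\<Sum>p\<in>UNIV. if fst p = a then g p else 0) = (\<Sum>i\<in>UNIV. g (a, i))"
    for g :: "'a \<times> 'b \<Rightarrow> complex" and a
  proof -
    have "(\<Sum>i\<in>UNIV. if a' = a then g (a', i) else 0) = (if a' = a then \<Sum>i\<in>UNIV. g (a', i) else 0)"
      for a'
      by simp
    then show ?thesis
      by (simp add: sum_prod_UNIV)
  qed
  have "0 \<le> Re (\<Sum>i\<in>UNIV. \<Sum>j\<in>UNIV. F a i j)" for a
  proof -
    have "0 \<le> Re (\<Sum>p\<in>UNIV. \<Sum>q\<in>UNIV. cnj (w a $ p) * M $ p $ q * w a $ q)"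
      using assms unfolding psd_def by blast
    also have "(\<Sum>p\<in>UNIV. \<Sum>q\<in>UNIV. cnj (w a $ p) * M $ p $ q * w a $ q)
      = (\<Sum>p\<in>UNIV. if fst p = a then
          (\<Sum>q\<in>UNIV. if fst q = a then cnj (v $ snd p) * M $ p $ q * v $ snd q else 0) else 0)"
      by (intro sum.cong refl) (auto simp: w_def intro: sum.cong)
    also have "\<dots> = (\<Sum>i\<in>UNIV. \<Sum>j\<in>UNIV. F a i j)"
      by (simp only: * F_def fst_conv snd_conv)
    finally show ?thesis .
  qed
  then have "0 \<le> Re (\<Sum>a\<in>UNIV. \<Sum>i\<in>UNIV. \<Sum>j\<in>UNIV. F a i j)"
    by (subst Re_sum) (rule sum_nonneg)
  also have "(\<Sum>a\<in>UNIV. \<Sum>i\<in>UNIV. \<Sum>j\<in>UNIV. F a i j) = (\<Sum>i\<in>UNIV. \<Sum>a\<in>UNIV. \<Sum>j\<in>UNIV. F a i j)"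
    by (rule sum.swap)
  also have "\<dots> = (\<Sum>i\<in>UNIV. \<Sum>j\<in>UNIV. \<Sum>a\<in>UNIV. F a i j)"
    by (intro sum.cong refl sum.swap)
  also have "\<dots> = (\<Sum>i\<in>UNIV. \<Sum>j\<in>UNIV. cnj (v $ i) * ptrace_fst M $ i $ j * v $ j)"
    by (simp add: F_def ptrace_fst_def sum_distrib_left sum_distrib_right)
  finally show "0 \<le> Re (\<Sum>i\<in>UNIV. \<Sum>j\<in>UNIV. cnj (v $ i) * ptrace_fst M $ i $ j * v $ j)" .
qed

lemma trace_ptrace_fst: "trace (ptrace_fst M) = trace M"
  unfolding trace_def ptrace_fst_def sum_prod_UNIV by simp (rule sum.swap)

lemma ptrace_fst_scaleR: "ptrace_fst (c *\<^sub>R M) = c *\<^sub>R ptrace_fst M"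
  by (simp add: ptrace_fst_def vec_eq_iff scaleR_sum_right)

lemma ptrace_fst_0 [simp]: "ptrace_fst 0 = 0"
  by (simp add: ptrace_fst_def vec_eq_iff)

lemma kron_mat_1_mult_left:
  "(kron (mat 1) N ** M) $ (a, i) $ q = (\<Sum>k\<in>UNIV. N $ i $ k * M $ (a, k) $ q)"
proof -
  have "(kron (mat 1) N ** M) $ (a, i) $ q
      = (\<Sum>a'\<in>UNIV. \<Sum>k\<in>UNIV. kron (mat 1) N $ (a, i) $ (a', k) * M $ (a', k) $ q)"
    by (simp add: matrix_matrix_mult_def sum_prod_UNIV)
  also have "\<dots> = (\<Sum>a'\<in>UNIV. if a = a' then \<Sum>k\<in>UNIV. N $ i $ k * M $ (a', k) $ q else 0)"
    by (intro sum.cong refl) (simp add: kron_def mat_def)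
  finally show ?thesis
    by simp
qed

lemma kron_mat_1_mult_right:
  "(M ** kron (mat 1) N) $ p $ (a, j) = (\<Sum>k\<in>UNIV. M $ p $ (a, k) * N $ k $ j)"
proof -
  have "(M ** kron (mat 1) N) $ p $ (a, j)
      = (\<Sum>a'\<in>UNIV. \<Sum>k\<in>UNIV. M $ p $ (a', k) * kron (mat 1) N $ (a', k) $ (a, j))"
    by (simp add: matrix_matrix_mult_def sum_prod_UNIV)
  also have "\<dots> = (\<Sum>a'\<in>UNIV. if a' = a then \<Sum>k\<in>UNIV. M $ p $ (a', k) * N $ k $ j else 0)"
    by (intro sum.cong refl) (simp add: kron_def mat_def)
  finally show ?thesis
    by simp
qed

lemma cadj_kron: "cadj (kron M N) = kron (cadj M) (cadj N)"
  by (simp add: cadj_def kron_def vec_eq_iff)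

text \<open>An operator on the second factor alone does not touch the index being summed, so it
  moves out of the partial trace.\<close>

lemma ptrace_fst_kron_mult_left: "ptrace_fst (kron (mat 1) N ** M) = N ** ptrace_fst M"
proof -
  have "ptrace_fst (kron (mat 1) N ** M) $ i $ j = (N ** ptrace_fst M) $ i $ j" for i j
  proof -
    have "ptrace_fst (kron (mat 1) N ** M) $ i $ j
        = (\<Sum>a\<in>UNIV. \<Sum>k\<in>UNIV. N $ i $ k * M $ (a, k) $ (a, j))"
      by (simp add: ptrace_fst_def kron_mat_1_mult_left)
    also have "\<dots> = (\<Sum>k\<in>UNIV. \<Sum>a\<in>UNIV. N $ i $ k * M $ (a, k) $ (a, j))"
      by (rule sum.swap)
    also have "\<dots> = (N ** ptrace_fst M) $ i $ j"
      by (simp add: matrix_matrix_mult_def ptrace_fst_def sum_distrib_left)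
    finally show ?thesis .
  qed
  then show ?thesis by (simp add: vec_eq_iff)
qed

lemma ptrace_fst_kron_mult_right: "ptrace_fst (M ** kron (mat 1) N) = ptrace_fst M ** N"
proof -
  have "ptrace_fst (M ** kron (mat 1) N) $ i $ j = (ptrace_fst M ** N) $ i $ j" for i j
  proof -
    have "ptrace_fst (M ** kron (mat 1) N) $ i $ j
        = (\<Sum>a\<in>UNIV. \<Sum>k\<in>UNIV. M $ (a, i) $ (a, k) * N $ k $ j)"
      by (simp add: ptrace_fst_def kron_mat_1_mult_right)
    also have "\<dots> = (\<Sum>k\<in>UNIV. \<Sum>a\<in>UNIV. M $ (a, i) $ (a, k) * N $ k $ j)"
      by (rule sum.swap)
    also have "\<dots> = (ptrace_fst M ** N) $ i $ j"
      by (simp add: matrix_matrix_mult_def ptrace_fst_def sum_distrib_right)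
    finally show ?thesis .
  qed
  then show ?thesis by (simp add: vec_eq_iff)
qed

section \<open>Regrouping (AB)C as A(BC)\<close>

definition prod_reassoc :: "'a \<times> 'b \<times> 'c \<Rightarrow> ('a \<times> 'b) \<times> 'c" where
  "prod_reassoc = (\<lambda>(a, b, c). ((a, b), c))"

lemma bij_prod_reassoc: "bij prod_reassoc"
  by (rule o_bij [of "\<lambda>((a, b), c). (a, b, c)"]) (auto simp: prod_reassoc_def fun_eq_iff)

text \<open>Regrouping is a relabelling of the basis by a bijection, so its compatibility with
  products, adjoints and powers is a matter of reindexing.\<close>

lemma regroup_nth: "regroup M $ i $ j = M $ prod_reassoc i $ prod_reassoc j"
  by (simp add: regroup_def prod_reassoc_def split: prod.split)

lemma regroup_mult: "regroup (M ** N) = regroup M ** regroup N"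
proof -
  have "regroup (M ** N) $ i $ j = (regroup M ** regroup N) $ i $ j" for i j
    using sum.reindex_bij_betw [OF bij_prod_reassoc,
        of "\<lambda>k. M $ prod_reassoc i $ k * N $ k $ prod_reassoc j"]
    by (simp add: matrix_matrix_mult_def regroup_nth)
  then show ?thesis
    by (simp add: vec_eq_iff)
qed

lemma regroup_cadj: "regroup (cadj M) = cadj (regroup M)"
  by (simp add: vec_eq_iff regroup_nth cadj_def)

lemma regroup_scaleR: "regroup (c *\<^sub>R M) = c *\<^sub>R regroup M"
  by (simp add: vec_eq_iff regroup_nth)

lemma regroup_mat_1: "regroup (mat 1) = mat 1"
  by (auto simp: vec_eq_iff regroup_nth mat_def prod_reassoc_def)

lemma regroup_rdiag: "regroup (rdiag d) = rdiag (\<lambda>i. d (prod_reassoc i))"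
  by (auto simp: vec_eq_iff regroup_nth rdiag_def prod_reassoc_def)

text \<open>The identity on AB splits into the identities on A and on B. An operator on C thus
  becomes one that is trivial on A, and can leave the trace over A.\<close>

lemma regroup_kron_mat_1: "regroup (kron (mat 1) N) = kron (mat 1) (kron (mat 1) N)"
  by (simp add: vec_eq_iff regroup_nth prod_reassoc_def kron_def mat_def)

lemma cunitary_regroup: "cunitary U \<Longrightarrow> cunitary (regroup U)"
  by (metis cunitary_def regroup_cadj regroup_mat_1 regroup_mult)

lemma psd_regroup:
  assumes "psd M"
  shows "psd (regroup M)"
proof -
  obtain U d where U: "cunitary U" "M = U ** rdiag d ** cadj U" "\<And>i. d i \<ge> 0"
    by (rule psd_diagonalization [OF assms]) (rule that)
  then show ?thesis
    by (simp add: regroup_mult regroup_cadj regroup_rdiag psd_congruence psd_rdiag)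
qed

lemma mpow_regroup:
  assumes "psd M"
  shows "mpow (regroup M) s = regroup (mpow M s)"
proof -
  obtain U d where U: "cunitary U" "M = U ** rdiag d ** cadj U"
    by (rule psd_diagonalization [OF assms]) (rule that)
  then show ?thesis
    by (simp add: mpow_diagonalization cunitary_regroup regroup_mult regroup_cadj regroup_rdiag)
qed

text \<open>Tracing out A and then B traces out AB, so the full state and its BC marginal have the
  same marginal on C.\<close>

lemma ptrace_fst_ptrace_fst_regroup: "ptrace_fst (ptrace_fst (regroup M)) = ptrace_fst M"
proof -
  have "ptrace_fst (ptrace_fst (regroup M)) $ i $ j = ptrace_fst M $ i $ j" for i j
  proof -
    have "ptrace_fst (ptrace_fst (regroup M)) $ i $ j
        = (\<Sum>b\<in>UNIV. \<Sum>a\<in>UNIV. M $ ((a, b), i) $ ((a, b), j))"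
      by (simp add: ptrace_fst_def regroup_def)
    also have "\<dots> = (\<Sum>a\<in>UNIV. \<Sum>b\<in>UNIV. M $ ((a, b), i) $ ((a, b), j))"
      by (rule sum.swap)
    also have "\<dots> = ptrace_fst M $ i $ j"
      by (simp add: ptrace_fst_def sum_prod_UNIV)
    finally show ?thesis .
  qed
  then show ?thesis by (simp add: vec_eq_iff)
qed

subsection \<open>The sandwiched operator\<close>

text \<open>The operator X of the overview, separated from its outer power because only X itself has
  a simple partial trace.\<close>

definition sandwich ::
  "real \<Rightarrow> complex ^ ('a::finite \<times> 'b::finite) ^ ('a \<times> 'b) \<Rightarrow> complex ^ ('a \<times> 'b) ^ ('a \<times> 'b)" where
  "sandwich \<alpha> \<rho> =
     kron (mat 1) (mpow (ptrace_fst \<rho>) ((1 - \<alpha>) / (2 * \<alpha>))) ** \<rho> **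
     kron (mat 1) (mpow (ptrace_fst \<rho>) ((1 - \<alpha>) / (2 * \<alpha>)))"

lemma sandwiched_power_eq: "sandwiched_power \<alpha> \<rho> = mpow (sandwich \<alpha> \<rho>) \<alpha>"
  by (simp add: sandwiched_power_def sandwich_def Let_def)

lemma psd_sandwich:
  fixes \<rho> :: "complex ^ ('a::finite \<times> 'b::finite) ^ ('a \<times> 'b)"
  assumes "psd \<rho>"
  shows "psd (sandwich \<alpha> \<rho>)"
proof -
  define N where "N = mpow (ptrace_fst \<rho>) ((1 - \<alpha>) / (2 * \<alpha>))"
  define S :: "complex ^ ('a \<times> 'b) ^ ('a \<times> 'b)" where "S = kron (mat 1) N"
  have "cadj N = N"
    using psd_mpow [OF psd_ptrace_fst [OF assms]] by (simp add: N_def psd_iff)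
  then have "cadj S = S"
    by (simp add: S_def cadj_kron)
  then show ?thesis
    using psd_congruence [OF assms, of S] by (simp add: sandwich_def S_def N_def)
qed

lemma ptrace_fst_sandwich:
  assumes "psd \<rho>" and "\<alpha> > 0"
  shows "ptrace_fst (sandwich \<alpha> \<rho>) = mpow (ptrace_fst \<rho>) (1 / \<alpha>)"
proof -
  let ?B = "ptrace_fst \<rho>" and ?s = "(1 - \<alpha>) / (2 * \<alpha>)"
  have B: "psd ?B"
    using assms(1) by (rule psd_ptrace_fst)
  \<comment> \<open>Writing the middle factor as a first power lets the exponents add, also when
    \<open>?s\<close> is negative and \<open>?B\<close> singular.\<close>
  have "ptrace_fst (sandwich \<alpha> \<rho>) = mpow ?B ?s ** mpow ?B 1 ** mpow ?B ?s"
    by (simp add: sandwich_def ptrace_fst_kron_mult_left ptrace_fst_kron_mult_right mpow_1 [OF B])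
  also have "\<dots> = mpow ?B (?s + 1 + ?s)"
    by (simp only: mpow_mult [OF B])
  also have "?s + 1 + ?s = 1 / \<alpha>"
    using \<open>\<alpha> > 0\<close> by (simp add: field_simps)
  finally show ?thesis .
qed

text \<open>Both sandwiches use the same power of the marginal on C, and these outer factors act
  trivially on A. The trace over A therefore reaches \<rho> and turns it into its BC
  marginal.\<close>

lemma ptrace_fst_regroup_sandwich:
  "ptrace_fst (regroup (sandwich \<alpha> \<rho>)) = sandwich \<alpha> (ptrace_fst (regroup \<rho>))"
  by (simp only: sandwich_def regroup_mult regroup_kron_mat_1 ptrace_fst_kron_mult_left
      ptrace_fst_kron_mult_right ptrace_fst_ptrace_fst_regroup)

lemma quantum_state_ptrace_fst: "quantum_state \<rho> \<Longrightarrow> quantum_state (ptrace_fst \<rho>)"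
  by (simp add: quantum_state_def psd_ptrace_fst trace_ptrace_fst)

lemma quantum_state_regroup:
  assumes "quantum_state \<rho>"
  shows "quantum_state (regroup \<rho>)"
proof -
  have "trace (regroup \<rho>) = trace \<rho>"
    using sum.reindex_bij_betw [OF bij_prod_reassoc, of "\<lambda>i. \<rho> $ i $ i"]
    by (simp add: trace_def regroup_nth)
  with assms show ?thesis
    by (simp add: quantum_state_def psd_regroup)
qed

text \<open>The sandwich cannot vanish: its partial trace is a power of the nonzero marginal. This
  justifies the normalization and the splitting of logarithms of quotients.\<close>

lemma rtrace_sandwiched_power_pos:
  assumes "quantum_state \<rho>" and "\<alpha> > 0"
  shows "rtrace (sandwiched_power \<alpha> \<rho>) > 0"
proof -
  have \<rho>: "psd \<rho>" and B: "psd (ptrace_fst \<rho>)" "ptrace_fst \<rho> \<noteq> 0"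
    using assms(1) quantum_state_ptrace_fst [OF assms(1)]
    by (auto simp: quantum_state_def trace_def)
  have "rtrace (mpow (ptrace_fst \<rho>) (1 / \<alpha>)) > 0"
    using B by (rule rtrace_mpow_pos)
  then have "ptrace_fst (sandwich \<alpha> \<rho>) \<noteq> 0"
    using ptrace_fst_sandwich [OF \<rho> \<open>\<alpha> > 0\<close>] by (auto simp: rtrace_def trace_def)
  then have "sandwich \<alpha> \<rho> \<noteq> 0"
    by auto
  then show ?thesis
    unfolding sandwiched_power_eq by (intro rtrace_mpow_pos psd_sandwich \<rho>)
qed

section \<open>Evaluation of the entropies\<close>

text \<open>The inner power 1/\<alpha> undoes the power \<alpha> and turns c into
  \<open>c powr (1 / \<alpha>)\<close>; the outer power \<alpha> restores c. It is applied with c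
  the reciprocal of the normalizing trace.\<close>

lemma H_bar_up_mpow:
  assumes "psd X" and "c > 0" and "\<alpha> > 0" and "\<alpha> \<noteq> 1"
  shows "H_bar_up (1 / \<alpha>) (c *\<^sub>R mpow X \<alpha>)
    = 1 / (\<alpha> - 1) * ln (c * rtrace (mpow (ptrace_fst X) \<alpha>))"
proof -
  have "mpow (c *\<^sub>R mpow X \<alpha>) (1 / \<alpha>) = (c powr (1 / \<alpha>)) *\<^sub>R X"
    using assms by (simp add: mpow_scaleR psd_mpow mpow_mpow mpow_1)
  moreover have "mpow ((c powr (1 / \<alpha>)) *\<^sub>R ptrace_fst X) \<alpha> = c *\<^sub>R mpow (ptrace_fst X) \<alpha>"
    using assms by (simp add: mpow_scaleR psd_ptrace_fst powr_powr)
  moreover have "(1 / \<alpha>) / (1 - 1 / \<alpha>) = 1 / (\<alpha> - 1)"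
    using assms by (simp add: divide_simps)
  ultimately show ?thesis
    unfolding H_bar_up_def by (simp add: ptrace_fst_scaleR rtrace_scaleR)
qed

text \<open>With Q the normalizing trace, the right side is ln (1 / Q) / (\<alpha> - 1), which
  equals ln Q / (1 - \<alpha>).\<close>

lemma H_tilde_down_eq_H_bar_up:
  assumes "quantum_state \<rho>" and "\<alpha> > 0" and "\<alpha> \<noteq> 1"
  shows "H_tilde_down \<alpha> \<rho>
    = H_bar_up (1 / \<alpha>) ((1 / rtrace (sandwiched_power \<alpha> \<rho>)) *\<^sub>R sandwiched_power \<alpha> \<rho>)"
proof -
  have \<rho>: "psd \<rho>" and B: "psd (ptrace_fst \<rho>)" and tr: "rtrace (ptrace_fst \<rho>) = 1"
    using assms(1) quantum_state_ptrace_fst [OF assms(1)]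
    by (auto simp: quantum_state_def rtrace_def)
  have pos: "rtrace (mpow (sandwich \<alpha> \<rho>) \<alpha>) > 0"
    using rtrace_sandwiched_power_pos assms by (simp add: sandwiched_power_eq)
  \<comment> \<open>The partial trace of the sandwich is the power 1/\<alpha> of the marginal, so
    the power \<alpha> gives back the marginal, of trace one.\<close>
  have "rtrace (mpow (ptrace_fst (sandwich \<alpha> \<rho>)) \<alpha>) = 1"
    using assms tr by (simp add: ptrace_fst_sandwich [OF \<rho>] mpow_mpow [OF B] mpow_1 [OF B])
  then show ?thesis
    using assms pos
    by (simp add: H_tilde_down_def sandwiched_power_eq H_bar_up_mpow psd_sandwich \<rho> ln_div
        divide_simps) (simp add: algebra_simps)
qed

text \<open>Here the trace is R / Q instead of 1 / Q; its logarithm splits, and the R part is the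
  entropy of the BC marginal.\<close>

lemma H_tilde_down_chain:
  assumes "quantum_state \<rho>" and "\<alpha> > 0" and "\<alpha> \<noteq> 1"
  shows "H_tilde_down \<alpha> \<rho>
    = H_bar_up (1 / \<alpha>)
        (regroup ((1 / rtrace (sandwiched_power \<alpha> \<rho>)) *\<^sub>R sandwiched_power \<alpha> \<rho>))
      + H_tilde_down \<alpha> (ptrace_fst (regroup \<rho>))"
proof -
  have \<rho>: "psd \<rho>"
    using assms(1) by (simp add: quantum_state_def)
  define Q where "Q = rtrace (mpow (sandwich \<alpha> \<rho>) \<alpha>)"
  define R where "R = rtrace (mpow (sandwich \<alpha> (ptrace_fst (regroup \<rho>))) \<alpha>)"
  have pos: "Q > 0" "R > 0"
    using assms
    by (simp_all add: Q_def R_def rtrace_sandwiched_power_pos quantum_state_ptrace_fst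
        quantum_state_regroup flip: sandwiched_power_eq)
  have "H_bar_up (1 / \<alpha>) (regroup ((1 / Q) *\<^sub>R mpow (sandwich \<alpha> \<rho>) \<alpha>))
      = 1 / (\<alpha> - 1) * ln (1 / Q * R)"
    using assms pos
    by (simp add: regroup_scaleR psd_sandwich \<rho> psd_regroup H_bar_up_mpow
        ptrace_fst_regroup_sandwich R_def flip: mpow_regroup)
  then show ?thesis
    using assms pos
    by (simp add: H_tilde_down_def sandwiched_power_eq Q_def [symmetric] R_def [symmetric]
        ln_div divide_simps) (simp add: algebra_simps)
qed

theorem mainTheorem5:
  fixes \<alpha> :: real
  assumes "\<alpha> > 0" and "\<alpha> \<noteq> 1"
  shows
    "(\<forall>(\<rho> :: complex ^ ('a::finite \<times> 'b::finite) ^ ('a \<times> 'b)) \<rho>bar.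
        quantum_state \<rho> \<longrightarrow> quantum_state \<rho>bar \<longrightarrow>
        \<rho>bar = (1 / rtrace (sandwiched_power \<alpha> \<rho>)) *\<^sub>R sandwiched_power \<alpha> \<rho> \<longrightarrow>
        H_tilde_down \<alpha> \<rho> = H_bar_up (1 / \<alpha>) \<rho>bar)
     \<and>
     (\<forall>(\<rho> :: complex ^ (('a \<times> 'b) \<times> 'c::finite) ^ (('a \<times> 'b) \<times> 'c)) \<rho>tilde.
        quantum_state \<rho> \<longrightarrow>
        \<rho>tilde = (1 / rtrace (sandwiched_power \<alpha> \<rho>)) *\<^sub>R sandwiched_power \<alpha> \<rho> \<longrightarrow>
        H_tilde_down \<alpha> \<rho>
          = H_bar_up (1 / \<alpha>) (regroup \<rho>tilde) + H_tilde_down \<alpha> (ptrace_fst (regroup \<rho>)) \<and>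
        H_bar_up (1 / \<alpha>) (regroup \<rho>tilde) + H_tilde_down \<alpha> (ptrace_fst (regroup \<rho>))
          = H_bar_up (1 / \<alpha>) \<rho>tilde)"
  \<comment> \<open>Read from right to left, the two lemmas collapse every other side to
    \<open>H_tilde_down \<alpha> \<rho>\<close>; the last equality uses the first lemma with AB as
    the first factor.\<close>
  by (simp add: assms flip: H_tilde_down_eq_H_bar_up H_tilde_down_chain)

end
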